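(* Let $T$ be a random vector taking values in $[-\infty,\infty)^d$ such that (T1) $\Pr[T_j>-\infty]>0$ for all $j=1,\dots,d$ and (T2) $\Pr[\max(T)>-\infty]=1$. Then $$S=T-\max(T)$$ is a spectral random vector, and the associated generalized Pareto distribution $\operatorname{GP}(\mathbf 1,\mathbf 0,\pi,\ell)=\operatorname{GP}_S(\mathbf 1,\mathbf 0,\mathcal L(S))$, i.e. the law of $S+E$ with $E$ unit exponential independent of $S$, is determined by $$\pi_j=\mathbb E[e^{T_j-\max(T)}],\quad j=1,\dots,d,$$ $$\ell(y)=\mathbb E\left[\max_{j=1,\dots,d}\left\{y_j\,\frac{e^{T_j-\max(T)}}{\mathbb E[e^{T_j-\max(T)}]}\right\}\right],\quad y\in[0,\infty)^d.$$ The associated cdf is given by $$H(z)=1-\mathbb E\bigl[1\wedge e^{\max(T-z)-\max(T)}\bigr],\qquad z\in\mathbb R^d.$$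
   Context: Conventions: operations and order relations between vectors are componentwise, scalars being applied to every component; $a\wedge b=\min(a,b)$; $\max(x)=\max(x_1,\dots,x_d)$; $e^{-\infty}=0$; $\mathcal L(\xi)$ is the law of $\xi$; $\mathbf 1=(1,\dots,1)$, $\mathbf 0=(0,\dots,0)$. A random vector $S$ with values in $[-\infty,0]^d$ is called a spectral random vector if $\Pr[\max(S_1,\dots,S_d)=0]=1$ and $\Pr[S_j>-\infty]>0$ for all $j=1,\dots,d$. A function $\ell:[0,\infty)^d\to[0,\infty)$ is a stable tail dependence function (stdf) if there is a random vector $V$ with values in $[0,\infty)^d$ and $\mathbb E[V_j]=1$ for all $j$ such that $\ell(y)=\mathbb E[\max_{j}(y_jV_j)]$ for all $y\in[0,\infty)^d$. For $\pi\in(0,1]^d$ and a stdf $\ell$ with $\ell(\pi)=1$, $\operatorname{GP}(\mathbf 1,\mathbf 0,\pi,\ell)$ is the probability distribution concentrated on $[-\infty,\infty)^d\setminus[-\infty,0]^d$ with cdf $H(z)=\ell(\pi e^{-(z\wedge 0)})-\ell(\pi e^{-z})$, $z\in\mathbb R^d$. For a spectral random vector $S$, $\operatorname{GP}_S(\mathbf 1,\mathbf 0,\mathcal L(S))$ denotes the law of $S+E$, where $E$ is a unit exponential random variable independent of $S$; it is of the form $\operatorname{GP}(\mathbf 1,\mathbf 0,\pi,\ell)$ for a unique pair $(\pi,\ell)$. *)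

theory Defs
  imports "HOL-Probability.Probability"
begin

text \<open>
  A random vector in dimension \<open>d\<close> is a Borel function with values in \<open>ereal ^ 'd\<close> or
  \<open>real ^ 'd\<close>, where \<open>d = CARD('d)\<close>. Operations and order relations on vectors are
  componentwise.
\<close>

definition vmax :: "('a::linorder) ^ 'd \<Rightarrow> 'a" where
  "vmax x = Max (range (\<lambda>j. x $ j))"

text \<open>
  The exponential with the convention \<open>exp (-\<infinity>) = 0\<close>. The value at \<open>\<infinity>\<close> is irrelevant: all
  arguments used below are almost surely less than \<open>\<infinity>\<close>.
\<close>

definition exp_ext :: "ereal \<Rightarrow> real" where
  "exp_ext x = (if x = -\<infinity> then 0 else exp (real_of_ereal x))"

text \<open>
  ``With values in \<open>A\<close>'' is meant almost surely. This matters for \<open>T - max T\<close>, which has no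
  meaningful value on the null event \<open>max T = -\<infinity>\<close>.
\<close>

definition random_vector_in ::
  "'a measure \<Rightarrow> (('b::topological_space) ^ 'd) set \<Rightarrow> ('a \<Rightarrow> 'b ^ 'd) \<Rightarrow> bool" where
  "random_vector_in M A X \<longleftrightarrow> prob_space M \<and> X \<in> borel_measurable M \<and> (AE \<omega> in M. X \<omega> \<in> A)"

definition spectral_random_vector :: "'a measure \<Rightarrow> ('a \<Rightarrow> ereal ^ 'd) \<Rightarrow> bool" where
  "spectral_random_vector M S \<longleftrightarrow>
     random_vector_in M {x. \<forall>j. x $ j \<le> 0} S \<and>
     \<P>(\<omega> in M. vmax (S \<omega>) = 0) = 1 \<and>
     (\<forall>j. \<P>(\<omega> in M. S \<omega> $ j > -\<infinity>) > 0)"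

text \<open>
  The probability space carrying \<open>V\<close> ranges over measures on \<open>real ^ 'd\<close>; this is no
  restriction, since only the law of \<open>V\<close> enters. The value of \<open>l\<close> outside of
  \<open>[0,\<infinity>)\<^sup>d\<close> is irrelevant.
\<close>

definition is_stdf :: "(real ^ 'd \<Rightarrow> real) \<Rightarrow> bool" where
  "is_stdf l \<longleftrightarrow>
     (\<exists>(N :: (real ^ 'd) measure) V.
        random_vector_in N {x. \<forall>j. 0 \<le> x $ j} V \<and>
        (\<forall>j. integrable N (\<lambda>\<omega>. V \<omega> $ j) \<and> (\<integral>\<omega>. V \<omega> $ j \<partial>N) = 1) \<and>
        (\<forall>y. (\<forall>j. 0 \<le> y $ j) \<longrightarrow> l y = (\<integral>\<omega>. vmax (\<chi> j. y $ j * V \<omega> $ j) \<partial>N)))"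

definition vcdf :: "(ereal ^ 'd) measure \<Rightarrow> real ^ 'd \<Rightarrow> real" where
  "vcdf P z = measure P {x. \<forall>j. x $ j \<le> ereal (z $ j)}"

text \<open>
  \<open>is_GP \<pi> l P\<close>: the parameters \<open>(\<pi>, l)\<close> are admissible and \<open>P\<close> is the distribution
  \<open>GP(1, 0, \<pi>, l)\<close>.
\<close>

definition is_GP :: "real ^ 'd \<Rightarrow> (real ^ 'd \<Rightarrow> real) \<Rightarrow> (ereal ^ 'd) measure \<Rightarrow> bool" where
  "is_GP \<pi> l P \<longleftrightarrow>
     (\<forall>j. 0 < \<pi> $ j \<and> \<pi> $ j \<le> 1) \<and> is_stdf l \<and> l \<pi> = 1 \<and>
     prob_space P \<and> sets P = sets borel \<and>
     (AE x in P. x \<in> {x. \<forall>j. x $ j < \<infinity>} - {x. \<forall>j. x $ j \<le> 0}) \<and>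
     (\<forall>z. vcdf P z = l (\<chi> j. \<pi> $ j * exp (- min (z $ j) 0)) - l (\<chi> j. \<pi> $ j * exp (- (z $ j))))"

text \<open>
  \<open>GP\<^sub>S(1, 0, \<nu>)\<close>: the law of \<open>S + E\<close> when \<open>S\<close> has law \<open>\<nu>\<close> and \<open>E\<close> is
  unit exponential and independent of \<open>S\<close>, i.e. \<open>(S, E)\<close> has the product law.
\<close>

definition GP_S :: "(ereal ^ 'd) measure \<Rightarrow> (ereal ^ 'd) measure" where
  "GP_S \<nu> = distr (\<nu> \<Otimes>\<^sub>M density lborel (exponential_density 1)) borel
     (\<lambda>(s, e). \<chi> j. s $ j + ereal e)"

lemma borel_measurable_vec_lambda:
  fixes f :: "'a \<Rightarrow> 'd::finite \<Rightarrow> ereal"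
  assumes "\<And>j. (\<lambda>\<omega>. f \<omega> j) \<in> borel_measurable M"
  shows "(\<lambda>\<omega>. \<chi> j. f \<omega> j) \<in> borel_measurable M"
proof -
  have "f \<in> borel_measurable M"
    using assms by (rule measurable_coordinatewise_then_product)
  moreover have "(\<lambda>g :: 'd \<Rightarrow> ereal. \<chi> j. g j) \<in> borel_measurable borel"
    by (intro borel_measurable_continuous_onI continuous_on_vec_lambda
        continuous_on_product_coordinates)
  ultimately show ?thesis
    by (rule measurable_compose)
qed

lemma borel_measurable_vec_component:
  "(\<lambda>x :: ereal ^ 'd. x $ j) \<in> borel_measurable borel"
  by (intro borel_measurable_continuous_onI continuous_intros)

lemma GP_S_eq_law_of_sum:
  fixes S :: "'a \<Rightarrow> ereal ^ 'd" and E :: "'a \<Rightarrow> real"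
  assumes "prob_space M"
    and S: "S \<in> borel_measurable M"
    and E: "distributed M lborel E (exponential_density 1)"
    and indep: "prob_space.indep_set M {S -` A \<inter> space M |A. A \<in> sets borel}
      {E -` B \<inter> space M |B. B \<in> sets borel}"
  shows "distr M borel (\<lambda>\<omega>. \<chi> j. S \<omega> $ j + ereal (E \<omega>)) = GP_S (distr M borel S)"
proof -
  interpret prob_space M by fact
  have E': "E \<in> borel_measurable M"
    using distributed_measurable[OF E] by simp
  have "distr M borel E = distr M lborel E"
    by (rule distr_cong) auto
  also have "\<dots> = density lborel (exponential_density 1)"
    using E unfolding distributed_def by simp
  finally have lawE: "distr M borel E = density lborel (exponential_density 1)" .
  have prod: "distr M borel S \<Otimes>\<^sub>M distr M borel E = distr M (borel \<Otimes>\<^sub>M borel) (\<lambda>\<omega>. (S \<omega>, E \<omega>))"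
  proof (rule pair_measure_eqI)
    show "sigma_finite_measure (distr M borel S)" "sigma_finite_measure (distr M borel E)"
      using S E' by (auto intro!: prob_space_distr prob_space_imp_sigma_finite)
    show "sets (distr M borel S \<Otimes>\<^sub>M distr M borel E) =
        sets (distr M (borel \<Otimes>\<^sub>M borel) (\<lambda>\<omega>. (S \<omega>, E \<omega>)))"
      by (simp cong: sets_pair_measure_cong)
  next
    fix A B assume A: "A \<in> sets (distr M borel S)" and B: "B \<in> sets (distr M borel E)"
    have "(\<lambda>\<omega>. (S \<omega>, E \<omega>)) -` (A \<times> B) \<inter> space M = (S -` A \<inter> space M) \<inter> (E -` B \<inter> space M)"
      by auto
    moreover have "prob ((S -` A \<inter> space M) \<inter> (E -` B \<inter> space M)) =
        prob (S -` A \<inter> space M) * prob (E -` B \<inter> space M)"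
      using A B by (intro indep_setD[OF indep]) auto
    ultimately show "emeasure (distr M borel S) A * emeasure (distr M borel E) B =
        emeasure (distr M (borel \<Otimes>\<^sub>M borel) (\<lambda>\<omega>. (S \<omega>, E \<omega>))) (A \<times> B)"
      using A B S E' by (simp add: emeasure_distr emeasure_eq_measure ennreal_mult)
  qed
  have "(\<lambda>p :: (ereal ^ 'd) \<times> real. \<chi> j. fst p $ j + ereal (snd p))
      \<in> borel_measurable (borel \<Otimes>\<^sub>M borel)"
    by (intro borel_measurable_vec_lambda borel_measurable_ereal_add
        measurable_compose[OF measurable_fst borel_measurable_vec_component]
        borel_measurable_ereal measurable_snd)
  then have plus: "(\<lambda>(s :: ereal ^ 'd, e). \<chi> j. s $ j + ereal e) \<in> borel_measurable (borel \<Otimes>\<^sub>M borel)"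
    by (simp add: case_prod_beta)
  show ?thesis
    unfolding GP_S_def lawE[symmetric] prod
    by (subst distr_distr[OF plus]) (use S E' in \<open>auto simp: comp_def\<close>)
qed

end

theory Submission
  imports Defs
begin

text \<open>
  With \<open>R j = exp (S j)\<close> and \<open>a = max (R * exp (- z))\<close>, the event \<open>S + E \<le> z\<close> is \<open>E \<le> - ln a\<close>, which has
  conditional probability \<open>1 - min 1 a\<close> given \<open>S\<close>. Since \<open>max R = 1\<close>, replacing \<open>z\<close> by \<open>min z 0\<close> turns
  \<open>a\<close> into \<open>max 1 a\<close>, so the identity \<open>max 1 a - a = 1 - min 1 a\<close> puts the cdf into generalized Pareto
  form with \<open>\<pi> = E R\<close>. Conversely, the cdf of a generalized Pareto distribution determines both parameters.
\<close>

subsection \<open>Componentwise maxima\<close>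

lemma vmax_le_iff: "vmax x \<le> a \<longleftrightarrow> (\<forall>j. x $ j \<le> a)"
  unfolding vmax_def by (subst Max_le_iff) auto

lemma vmax_less_iff: "vmax x < a \<longleftrightarrow> (\<forall>j. x $ j < a)"
  unfolding vmax_def by (subst Max_less_iff) auto

lemma le_vmax: "x $ j \<le> vmax x"
  using vmax_le_iff by blast

lemma vmax_attained: "\<exists>j. x $ j = vmax x"
proof -
  have "vmax x \<in> range (\<lambda>j. x $ j)"
    unfolding vmax_def by (intro Max_in) auto
  then show ?thesis by auto
qed

lemma vmax_eqI:
  assumes "\<And>j. x $ j \<le> a" "x $ i = a"
  shows "vmax x = a"
  using assms vmax_le_iff le_vmax by (metis order_antisym)

lemma vmax_mono: "(\<And>j. x $ j \<le> y $ j) \<Longrightarrow> vmax x \<le> vmax y"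
  by (meson vmax_le_iff le_vmax order_trans)

lemma borel_measurable_vmax:
  fixes f :: "'a \<Rightarrow> 'd::finite \<Rightarrow> 'b::{second_countable_topology, linorder_topology}"
  assumes "\<And>j. (\<lambda>\<omega>. f \<omega> j) \<in> borel_measurable M"
  shows "(\<lambda>\<omega>. vmax (\<chi> j. f \<omega> j)) \<in> borel_measurable M"
proof -
  have "(\<lambda>\<omega>. Max ((\<lambda>j. f \<omega> j) ` UNIV)) \<in> borel_measurable M"
    using assms by (intro borel_measurable_Max) auto
  then show ?thesis by (simp add: vmax_def)
qed

lemma vmax_scale:
  fixes x :: "real ^ 'd"
  assumes "0 \<le> c"
  shows "vmax (\<chi> j. c * x $ j) = c * vmax x"
proof -
  obtain i where "x $ i = vmax x" using vmax_attained by blast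
  then show ?thesis
    using assms by (intro vmax_eqI[of _ _ i]) (auto intro: mult_left_mono le_vmax)
qed

lemma vmax_nonneg:
  fixes x :: "real ^ 'd"
  assumes "\<And>j. 0 \<le> x $ j"
  shows "0 \<le> vmax x"
  using assms le_vmax order_trans by blast

text \<open>The maximum is one of its finitely many entries, so it is dominated in absolute value by
  the sum of their absolute values. No sign condition on \<open>y\<close> or \<open>V\<close>
  enters.\<close>

lemma integrable_vmax_mult:
  fixes V :: "'a \<Rightarrow> real ^ 'd"
  assumes "\<And>j. integrable N (\<lambda>\<omega>. V \<omega> $ j)"
  shows "integrable N (\<lambda>\<omega>. vmax (\<chi> j. y $ j * V \<omega> $ j))"
proof (rule Bochner_Integration.integrable_bound)
  show "integrable N (\<lambda>\<omega>. \<Sum>j\<in>UNIV. \<bar>y $ j * V \<omega> $ j\<bar>)"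
    using assms by (intro Bochner_Integration.integrable_sum integrable_abs integrable_mult_right)
  show "(\<lambda>\<omega>. vmax (\<chi> j. y $ j * V \<omega> $ j)) \<in> borel_measurable N"
    using assms by (intro borel_measurable_vmax borel_measurable_times) auto
  have "\<bar>vmax (\<chi> j. y $ j * V \<omega> $ j)\<bar> \<le> (\<Sum>j\<in>UNIV. \<bar>y $ j * V \<omega> $ j\<bar>)" for \<omega>
  proof -
    obtain i where "(\<chi> j. y $ j * V \<omega> $ j) $ i = vmax (\<chi> j. y $ j * V \<omega> $ j)"
      using vmax_attained by blast
    then show ?thesis
      by (metis (mono_tags, lifting) UNIV_I abs_ge_zero finite member_le_sum vec_lambda_beta)
  qed
  then show "AE \<omega> in N. norm (vmax (\<chi> j. y $ j * V \<omega> $ j)) \<le> norm (\<Sum>j\<in>UNIV. \<bar>y $ j * V \<omega> $ j\<bar>)"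
    by (simp add: sum_nonneg)
qed

subsection \<open>Stable tail dependence functions and uniqueness of the parameters\<close>

lemma is_stdf_scale:
  assumes "is_stdf l" "0 \<le> c" "\<And>j. 0 \<le> y $ j"
  shows "l (\<chi> j. c * y $ j) = c * l y"
proof -
  obtain N :: "(real ^ 'a) measure" and V where
    l: "\<And>y. (\<forall>j. 0 \<le> y $ j) \<Longrightarrow> l y = (\<integral>\<omega>. vmax (\<chi> j. y $ j * V \<omega> $ j) \<partial>N)"
    using assms(1) unfolding is_stdf_def by blast
  show ?thesis
    using assms(2,3) vmax_scale[OF assms(2), of "\<chi> j. y $ j * V _ $ j"]
    by (simp add: l mult.assoc)
qed

text \<open>The weights \<open>axis i 1\<close> turn every entry except the \<open>i\<close>-th into
  0, and \<open>V \<omega> $ i\<close> is almost surely nonnegative, so the maximum is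
  \<open>V \<omega> $ i\<close>, which has mean 1.\<close>

lemma is_stdf_axis:
  assumes "is_stdf l"
  shows "l (axis i 1) = 1"
proof -
  obtain N :: "(real ^ 'a) measure" and V where
    l: "\<And>y. (\<forall>j. 0 \<le> y $ j) \<Longrightarrow> l y = (\<integral>\<omega>. vmax (\<chi> j. y $ j * V \<omega> $ j) \<partial>N)"
    and V: "random_vector_in N {x. \<forall>j. 0 \<le> x $ j} V" "(\<integral>\<omega>. V \<omega> $ i \<partial>N) = 1"
      "\<And>j. integrable N (\<lambda>\<omega>. V \<omega> $ j)"
    using assms unfolding is_stdf_def by blast
  have "l (axis i 1) = (\<integral>\<omega>. vmax (\<chi> j. axis i 1 $ j * V \<omega> $ j) \<partial>N)"
    by (intro l) (simp add: axis_def)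
  also have "\<dots> = (\<integral>\<omega>. V \<omega> $ i \<partial>N)"
  proof (rule integral_cong_AE)
    show "AE \<omega> in N. vmax (\<chi> j. axis i 1 $ j * V \<omega> $ j) = V \<omega> $ i"
      using V(1) unfolding random_vector_in_def
      by (auto elim!: eventually_mono intro!: vmax_eqI[of _ _ i] simp: axis_def)
  qed (use V(3) in \<open>auto intro!: borel_measurable_vmax borel_measurable_times\<close>)
  finally show ?thesis using V(2) by simp
qed

text \<open>A sandwich between \<open>l y\<close> and \<open>l y + l c / Suc n\<close>: the lower
  bound is monotonicity in the weights, the upper bound is subadditivity of the maximum. Its purpose
  is to reach boundary points of the orthant from the interior.\<close>

lemma is_stdf_tendsto:
  assumes "is_stdf l" and y: "\<And>j. 0 \<le> y $ j" and c: "\<And>j. 0 \<le> c $ j"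
  shows "(\<lambda>n. l (\<chi> j. y $ j + c $ j / Suc n)) \<longlonglongrightarrow> l y"
proof -
  obtain N :: "(real ^ 'a) measure" and V where
    l: "\<And>y. (\<forall>j. 0 \<le> y $ j) \<Longrightarrow> l y = (\<integral>\<omega>. vmax (\<chi> j. y $ j * V \<omega> $ j) \<partial>N)"
    and V: "random_vector_in N {x. \<forall>j. 0 \<le> x $ j} V" "\<And>j. integrable N (\<lambda>\<omega>. V \<omega> $ j)"
    using assms(1) unfolding is_stdf_def by blast
  have nn: "AE \<omega> in N. \<forall>j. 0 \<le> V \<omega> $ j"
    using V(1) by (simp add: random_vector_in_def)
  have int: "integrable N (\<lambda>\<omega>. vmax (\<chi> j. y $ j * V \<omega> $ j))" for y :: "real ^ 'a"
    using V(2) by (rule integrable_vmax_mult)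
  have lower: "l y \<le> l (\<chi> j. y $ j + c $ j / Suc n)" for n
    unfolding l[OF allI[OF y]]
  proof (subst l)
    show "\<forall>j. 0 \<le> (\<chi> j. y $ j + c $ j / Suc n) $ j"
      using y c by simp
    show "(\<integral>\<omega>. vmax (\<chi> j. y $ j * V \<omega> $ j) \<partial>N) \<le>
        (\<integral>\<omega>. vmax (\<chi> j. (\<chi> j. y $ j + c $ j / Suc n) $ j * V \<omega> $ j) \<partial>N)"
    proof (rule integral_mono_AE)
      show "AE \<omega> in N. vmax (\<chi> j. y $ j * V \<omega> $ j) \<le>
          vmax (\<chi> j. (\<chi> j. y $ j + c $ j / Suc n) $ j * V \<omega> $ j)"
        using nn c by (auto elim!: eventually_mono intro!: vmax_mono mult_right_mono)
    qed (rule int)+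
  qed
  have upper: "l (\<chi> j. y $ j + c $ j / Suc n) \<le> l y + l c / Suc n" for n
  proof -
    have "l (\<chi> j. y $ j + c $ j / Suc n) =
        (\<integral>\<omega>. vmax (\<chi> j. (\<chi> j. y $ j + c $ j / Suc n) $ j * V \<omega> $ j) \<partial>N)"
      using y c by (intro l) simp
    also have "\<dots> \<le> (\<integral>\<omega>. vmax (\<chi> j. y $ j * V \<omega> $ j) + vmax (\<chi> j. c $ j * V \<omega> $ j) / Suc n \<partial>N)"
    proof (rule integral_mono)
      fix \<omega>
      have "(y $ j + c $ j / Suc n) * V \<omega> $ j \<le>
          vmax (\<chi> j. y $ j * V \<omega> $ j) + vmax (\<chi> j. c $ j * V \<omega> $ j) / Suc n" for j
        using le_vmax[of "\<chi> j. y $ j * V \<omega> $ j" j]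
          divide_right_mono[OF le_vmax[of "\<chi> j. c $ j * V \<omega> $ j" j], of "Suc n"]
        by (simp add: distrib_right)
      then show "vmax (\<chi> j. (\<chi> j. y $ j + c $ j / Suc n) $ j * V \<omega> $ j) \<le>
          vmax (\<chi> j. y $ j * V \<omega> $ j) + vmax (\<chi> j. c $ j * V \<omega> $ j) / Suc n"
        by (simp add: vmax_le_iff)
    qed (intro int Bochner_Integration.integrable_add integrable_divide)+
    also have "\<dots> = l y + l c / Suc n"
      using int y c by (simp add: l)
    finally show ?thesis .
  qed
  have "(\<lambda>n. l y + l c / Suc n) \<longlonglongrightarrow> l y"
    using tendsto_add[OF tendsto_const[of "l y"] lim_const_over_n[THEN LIMSEQ_Suc, of "l c"]] by simp
  then show ?thesis
    by (rule tendsto_sandwich[rotated 3, OF _]) (use lower upper in auto)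
qed

text \<open>
  For \<open>z \<ge> 0\<close> the cdf equals \<open>1 - l (\<pi> * exp (- z))\<close>, so it determines \<open>l\<close> on a box. Homogeneity
  and continuity extend this to the orthant, and the unit margins \<open>l (axis j 1) = 1\<close> separate
  \<open>\<pi>\<close> from \<open>l\<close>.
\<close>

lemma is_GP_unique:
  assumes GP: "is_GP \<pi> l P" "is_GP \<pi>' l' P"
  shows "\<pi> = \<pi>'" and "(\<forall>j. 0 \<le> y $ j) \<Longrightarrow> l y = l' y"
proof -
  have stdf: "is_stdf l" "is_stdf l'" and pos: "\<And>j. 0 < \<pi> $ j" "\<And>j. 0 < \<pi>' $ j"
    using GP by (auto simp: is_GP_def)
  \<comment> \<open>For \<open>z\<close> nonnegative the first term of the cdf is
    \<open>l \<pi> = 1\<close>.\<close>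
  have box: "l (\<chi> j. \<pi> $ j * exp (- (z $ j))) = 1 - vcdf P z"
    if "is_GP \<pi> l P" "\<And>j. 0 \<le> z $ j" for \<pi> z and l :: "real ^ 'a \<Rightarrow> real"
    using that by (simp add: is_GP_def min_absorb2 vec_lambda_unique)
  have pos_eq: "l (\<chi> j. \<pi> $ j * w $ j) = l' (\<chi> j. \<pi>' $ j * w $ j)" if w: "\<And>j. 0 < w $ j" for w
  proof -
    \<comment> \<open>Dividing by the largest weight brings all weights into (0,1], where they have
      the form \<open>exp (- (z $ j))\<close> with \<open>z\<close> nonnegative; homogeneity
      restores the factor \<open>c\<close>.\<close>
    define c where "c = vmax w"
    define z :: "real ^ 'a" where "z = (\<chi> j. ln (c / w $ j))"
    have c: "0 < c" using w le_vmax less_le_trans unfolding c_def by blast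
    have z: "0 \<le> z $ j" for j
      using w[of j] le_vmax[of w j] by (simp add: z_def c_def)
    have wz: "w $ j = c * exp (- (z $ j))" for j
      using w[of j] c by (simp add: z_def exp_minus)
    have *: "l (\<chi> j. \<pi> $ j * w $ j) = c * (1 - vcdf P z)"
      if "is_GP \<pi> l P" for \<pi> and l :: "real ^ 'a \<Rightarrow> real"
    proof -
      have "l (\<chi> j. \<pi> $ j * w $ j) = l (\<chi> j. c * (\<chi> j. \<pi> $ j * exp (- (z $ j))) $ j)"
        by (simp add: wz mult.left_commute)
      also have "\<dots> = c * l (\<chi> j. \<pi> $ j * exp (- (z $ j)))"
        using that c by (intro is_stdf_scale) (auto simp: is_GP_def less_imp_le)
      finally show ?thesis using box[OF that z] by simp
    qed
    show ?thesis using *[OF GP(1)] *[OF GP(2)] by simp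
  qed
  have eq: "l (\<chi> j. \<pi> $ j * w $ j) = l' (\<chi> j. \<pi>' $ j * w $ j)" if w: "\<And>j. 0 \<le> w $ j" for w
  proof (rule LIMSEQ_unique)
    \<comment> \<open>A zero weight corresponds to no finite \<open>z\<close>, so it is approximated
      by positive ones. Multiplied by \<open>\<pi>\<close>, the perturbation becomes
      \<open>\<pi> $ j / Suc n\<close>, that is, direction \<open>c = \<pi>\<close> in
      \<open>is_stdf_tendsto\<close>.\<close>
    have *: "(\<lambda>n. l (\<chi> j. \<pi> $ j * (w $ j + 1 / Suc n))) \<longlonglongrightarrow> l (\<chi> j. \<pi> $ j * w $ j)"
      if "is_stdf l" "\<And>j. 0 < \<pi> $ j" for \<pi> and l :: "real ^ 'a \<Rightarrow> real"
      using is_stdf_tendsto[OF that(1), of "\<chi> j. \<pi> $ j * w $ j" \<pi>] that(2) w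
      by (simp add: distrib_left less_imp_le)
    show "(\<lambda>n. l (\<chi> j. \<pi> $ j * (w $ j + 1 / Suc n))) \<longlonglongrightarrow> l (\<chi> j. \<pi> $ j * w $ j)"
      using stdf pos by (intro *)
    have "l (\<chi> j. \<pi> $ j * (w $ j + 1 / Suc n)) = l' (\<chi> j. \<pi>' $ j * (w $ j + 1 / Suc n))" for n
      using pos_eq[of "\<chi> j. w $ j + 1 / Suc n"] w by (simp add: add_nonneg_pos)
    then show "(\<lambda>n. l (\<chi> j. \<pi> $ j * (w $ j + 1 / Suc n))) \<longlonglongrightarrow> l' (\<chi> j. \<pi>' $ j * w $ j)"
      using *[OF stdf(2) pos(2)] by simp
  qed
  have margin: "l (\<chi> j. \<pi> $ j * axis i 1 $ j) = \<pi> $ i"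
    if "is_stdf l" "\<And>j. 0 < \<pi> $ j" for \<pi> i and l :: "real ^ 'a \<Rightarrow> real"
  proof -
    \<comment> \<open>Only the \<open>i\<close>-th entry is nonzero, so \<open>\<pi> $ i\<close> can
      be pulled out by homogeneity, leaving the unit margin.\<close>
    have "(\<chi> j. \<pi> $ j * axis i 1 $ j) = (\<chi> j. \<pi> $ i * axis i 1 $ j)"
      by (simp add: vec_eq_iff axis_def)
    then show ?thesis
      using is_stdf_scale[OF that(1), of "\<pi> $ i" "axis i 1"] is_stdf_axis[OF that(1), of i] that(2)
      by (simp add: axis_def less_imp_le)
  qed
  show "\<pi> = \<pi>'"
    using margin[OF stdf(1) pos(1)] margin[OF stdf(2) pos(2)] eq[of "axis _ 1"]
    by (simp add: vec_eq_iff axis_def)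
  \<comment> \<open>Once the two \<open>\<pi>\<close> agree, any \<open>y\<close> in the orthant is
    \<open>\<pi>\<close> times the weights \<open>y $ j / \<pi> $ j\<close>, since
    \<open>\<pi>\<close> is positive.\<close>
  then show "l y = l' y" if "\<forall>j. 0 \<le> y $ j"
    using eq[of "\<chi> j. y $ j / \<pi> $ j"] that pos by (simp add: less_imp_le less_imp_neq[symmetric])
qed

text \<open>For positive \<open>\<pi>\<close>, \<open>l\<close> is evaluated only at points of the
  orthant; otherwise both sides are false. This absorbs the arbitrary values of \<open>l\<close>
  outside the orthant.\<close>

lemma is_GP_cong:
  assumes "\<And>y. (\<forall>j. 0 \<le> y $ j) \<Longrightarrow> l y = l' y"
  shows "is_GP \<pi> l P \<longleftrightarrow> is_GP \<pi> l' P"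
proof (cases "\<forall>j. 0 < \<pi> $ j")
  case True
  then have "l (\<chi> j. \<pi> $ j * exp (z j)) = l' (\<chi> j. \<pi> $ j * exp (z j))" "l \<pi> = l' \<pi>" for z
    using assms by (simp_all add: less_imp_le)
  moreover have "is_stdf l \<longleftrightarrow> is_stdf l'"
    using assms by (simp add: is_stdf_def)
  ultimately show ?thesis
    by (simp add: is_GP_def)
qed (auto simp: is_GP_def)

subsection \<open>Spectral random vectors\<close>

lemma exp_ext_nonneg: "0 \<le> exp_ext x"
  by (simp add: exp_ext_def)

lemma exp_ext_0: "exp_ext 0 = 1"
  by (simp add: exp_ext_def zero_ereal_def)

lemma exp_ext_le_1: "x \<le> 0 \<Longrightarrow> exp_ext x \<le> 1"
  by (cases x) (auto simp: exp_ext_def)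

lemma exp_ext_pos_iff: "0 < exp_ext x \<longleftrightarrow> x > -\<infinity>"
  by (simp add: exp_ext_def)

lemma exp_ext_diff: "x < \<infinity> \<Longrightarrow> exp_ext (x - ereal z) = exp_ext x * exp (- z)"
  by (cases x) (auto simp: exp_ext_def exp_diff exp_minus divide_inverse)

text \<open>The hypotheses exclude \<open>\<infinity>\<close>, where \<open>exp_ext\<close> has the
  default value \<open>exp 0 = 1\<close> and monotonicity breaks down.\<close>

lemma exp_ext_le_iff: "x < \<infinity> \<Longrightarrow> y < \<infinity> \<Longrightarrow> exp_ext x \<le> exp_ext y \<longleftrightarrow> x \<le> y"
  by (cases x; cases y) (auto simp: exp_ext_def not_le)

lemma exp_ext_vmax:
  assumes "\<And>j. x $ j < \<infinity>"
  shows "exp_ext (vmax x) = vmax (\<chi> j. exp_ext (x $ j))"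
proof -
  have "vmax x < \<infinity>" using assms by (subst vmax_less_iff) blast
  then have "exp_ext (x $ j) \<le> exp_ext (vmax x)" for j
    using exp_ext_le_iff[OF assms] le_vmax by blast
  moreover obtain i where "x $ i = vmax x" using vmax_attained by blast
  ultimately show ?thesis
    by (intro vmax_eqI[symmetric, of _ _ i]) auto
qed

lemma borel_measurable_exp_ext:
  assumes "f \<in> borel_measurable M"
  shows "(\<lambda>x. exp_ext (f x)) \<in> borel_measurable M"
  using assms unfolding exp_ext_def by measurable

lemma borel_measurable_vec_lambda_real:
  fixes f :: "'a \<Rightarrow> 'd::finite \<Rightarrow> real"
  assumes "\<And>j. (\<lambda>\<omega>. f \<omega> j) \<in> borel_measurable M"
  shows "(\<lambda>\<omega>. \<chi> j. f \<omega> j) \<in> borel_measurable M"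
proof -
  have "f \<in> borel_measurable M"
    using assms by (rule measurable_coordinatewise_then_product)
  moreover have "(\<lambda>g :: 'd \<Rightarrow> real. \<chi> j. g j) \<in> borel_measurable borel"
    by (intro borel_measurable_continuous_onI continuous_on_vec_lambda
        continuous_on_product_coordinates)
  ultimately show ?thesis
    by (rule measurable_compose)
qed

lemma spectral_random_vectorD:
  assumes "spectral_random_vector M S"
  shows "prob_space M" and "(\<lambda>\<omega>. S \<omega> $ j) \<in> borel_measurable M"
    and "AE \<omega> in M. (\<forall>j. S \<omega> $ j \<le> 0) \<and> vmax (S \<omega>) = 0"
proof -
  show "prob_space M"
    using assms by (simp add: spectral_random_vector_def random_vector_in_def)
  then interpret prob_space M .
  have "S \<in> borel_measurable M"
    using assms by (simp add: spectral_random_vector_def random_vector_in_def)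
  then show [measurable]: "(\<lambda>\<omega>. S \<omega> $ j) \<in> borel_measurable M" for j
    by (rule measurable_compose[OF _ borel_measurable_vec_component])
  then have [measurable]: "(\<lambda>\<omega>. vmax (S \<omega>)) \<in> borel_measurable M"
    using borel_measurable_vmax[of "\<lambda>\<omega> j. S \<omega> $ j"] by simp
  have "AE \<omega> in M. vmax (S \<omega>) = 0"
    using assms by (subst prob_Collect_eq_1[symmetric]) (auto simp: spectral_random_vector_def)
  then show "AE \<omega> in M. (\<forall>j. S \<omega> $ j \<le> 0) \<and> vmax (S \<omega>) = 0"
    by eventually_elim (metis le_vmax)
qed

section \<open>The cdf of a spectral random vector plus an exponential variable\<close>

text \<open>This is the conditional probability given \<open>S = s\<close>. Some coordinate of
  \<open>s\<close> is 0, which makes the maximum on the right positive, so that its logarithm is a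
  genuine threshold for the exponential variable.\<close>

lemma emeasure_exponential_shift:
  fixes s :: "ereal ^ 'd"
  assumes "vmax s = 0"
  shows "emeasure (density lborel (exponential_density 1)) {e. \<forall>j. s $ j + ereal e \<le> ereal (z $ j)} =
    ennreal (1 - min 1 (vmax (\<chi> j. exp_ext (s $ j) * exp (- (z $ j)))))"
proof -
  define a where "a = vmax (\<chi> j. exp_ext (s $ j) * exp (- (z $ j)))"
  have fin: "s $ j \<le> 0" for j
    using assms le_vmax by metis
  obtain i where "s $ i = 0"
    using vmax_attained assms by metis
  then have "0 < exp_ext (s $ i) * exp (- (z $ i))"
    by (simp add: exp_ext_0)
  also have "\<dots> \<le> a"
    using le_vmax[of "\<chi> j. exp_ext (s $ j) * exp (- (z $ j))" i] by (simp add: a_def)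
  finally have a: "0 < a" .
  \<comment> \<open>A coordinate equal to \<open>-\<infinity>\<close> imposes no constraint on
    either side, because \<open>exp_ext\<close> vanishes there; for a finite one, exponentiate and
    rearrange.\<close>
  have iff: "s $ j + ereal e \<le> ereal (z $ j) \<longleftrightarrow> exp_ext (s $ j) * exp (- (z $ j)) \<le> exp (- e)" for j e
    using fin[of j] by (cases "s $ j") (auto simp: exp_ext_def simp flip: exp_add)
  have "{e. \<forall>j. s $ j + ereal e \<le> ereal (z $ j)} = {e. exp (ln a) \<le> exp (- e)}"
    using a by (simp add: iff a_def vmax_le_iff)
  also have "\<dots> = {..- ln a}"
    by auto
  \<comment> \<open>The exponential density is the Erlang density of index 0. Its distribution
    function at \<open>- ln a\<close> is \<open>1 - a\<close> if \<open>a \<le> 1\<close> and 0 if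
    \<open>a > 1\<close>.\<close>
  finally show ?thesis
    using a by (auto simp: emeasure_erlang_density erlang_CDF_0 a_def[symmetric] min_def)
qed

lemma borel_measurable_GP_S_sum:
  "(\<lambda>(s :: ereal ^ 'd, e). \<chi> j. s $ j + ereal e)
    \<in> borel_measurable (distr M borel S \<Otimes>\<^sub>M density lborel (exponential_density 1))"
proof -
  have "(\<lambda>p :: (ereal ^ 'd) \<times> real. \<chi> j. fst p $ j + ereal (snd p))
      \<in> borel_measurable (borel \<Otimes>\<^sub>M borel)"
    by (intro borel_measurable_vec_lambda borel_measurable_ereal_add
        measurable_compose[OF measurable_fst borel_measurable_vec_component]
        borel_measurable_ereal measurable_snd)
  moreover have "sets (distr M borel S \<Otimes>\<^sub>M density lborel (exponential_density 1)) =
      sets ((borel :: (ereal ^ 'd) measure) \<Otimes>\<^sub>M (borel :: real measure))"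
    by (intro sets_pair_measure_cong) auto
  ultimately show ?thesis
    by (simp add: case_prod_beta cong: measurable_cong_sets)
qed

lemma prob_space_GP_S:
  assumes "prob_space M" "S \<in> borel_measurable M"
  shows "prob_space (GP_S (distr M borel S))"
  unfolding GP_S_def
  using assms by (intro prob_space.prob_space_distr borel_measurable_GP_S_sum prob_space_pair
      prob_space_exponential_density) auto

text \<open>Fubini: slice the product law at \<open>S \<omega>\<close>, evaluate each slice by
  \<open>emeasure_exponential_shift\<close>, and integrate over \<open>M\<close>. The slice formula
  requires \<open>vmax (S \<omega>) = 0\<close>, hence the almost-everywhere congruence.\<close>

lemma vcdf_GP_S:
  fixes S :: "'a \<Rightarrow> ereal ^ 'd"
  assumes S: "spectral_random_vector M S"
  shows "vcdf (GP_S (distr M borel S)) z =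
    1 - (\<integral>\<omega>. min 1 (vmax (\<chi> j. exp_ext (S \<omega> $ j) * exp (- (z $ j)))) \<partial>M)"
proof -
  note [measurable] = spectral_random_vectorD(2)[OF S]
  have Sm: "S \<in> measurable M borel"
    using S by (simp add: spectral_random_vector_def random_vector_in_def)
  interpret prob_space M using S by (rule spectral_random_vectorD)
  let ?D = "density lborel (exponential_density 1)"
  let ?\<nu> = "distr M borel S"
  let ?f = "\<lambda>(s :: ereal ^ 'd, e). \<chi> j. s $ j + ereal e"
  let ?A = "{x :: ereal ^ 'd. \<forall>j. x $ j \<le> ereal (z $ j)}"
  let ?m = "\<lambda>\<omega>. min 1 (vmax (\<chi> j. exp_ext (S \<omega> $ j) * exp (- (z $ j))))"
  interpret D: prob_space ?D by (rule prob_space_exponential_density) simp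
  interpret P: prob_space "GP_S ?\<nu>" using Sm by (intro prob_space_GP_S) unfold_locales
  have "{x \<in> space borel. \<forall>j. (x :: ereal ^ 'd) $ j \<le> ereal (z $ j)} \<in> sets borel"
    by (intro sets.sets_Collect_countable_All borel_measurable_le borel_measurable_vec_component) simp
  then have A: "?A \<in> sets borel" by simp
  have m[measurable]: "?m \<in> borel_measurable M"
    by (intro borel_measurable_min borel_measurable_const borel_measurable_vmax
        borel_measurable_times borel_measurable_exp_ext spectral_random_vectorD(2)[OF S])
  have m_bounds: "0 \<le> ?m \<omega>" "?m \<omega> \<le> 1" for \<omega>
    by (auto intro!: vmax_nonneg simp: exp_ext_nonneg)
  have int: "integrable M ?m"
    using m_bounds m by (intro integrable_const_bound[of _ 1]) auto
  have X: "?f -` ?A \<inter> space (?\<nu> \<Otimes>\<^sub>M ?D) \<in> sets (?\<nu> \<Otimes>\<^sub>M ?D)"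
    using borel_measurable_GP_S_sum A by (rule measurable_sets)
  have "emeasure (GP_S ?\<nu>) ?A = emeasure (?\<nu> \<Otimes>\<^sub>M ?D) (?f -` ?A \<inter> space (?\<nu> \<Otimes>\<^sub>M ?D))"
    unfolding GP_S_def by (rule emeasure_distr[OF borel_measurable_GP_S_sum A])
  also have "\<dots> = (\<integral>\<^sup>+s. emeasure ?D (Pair s -` (?f -` ?A \<inter> space (?\<nu> \<Otimes>\<^sub>M ?D))) \<partial>?\<nu>)"
    by (rule D.emeasure_pair_measure_alt[OF X])
  also have "\<dots> = (\<integral>\<^sup>+\<omega>. emeasure ?D (Pair (S \<omega>) -` (?f -` ?A \<inter> space (?\<nu> \<Otimes>\<^sub>M ?D))) \<partial>M)"
    using D.measurable_emeasure_Pair[OF X] Sm by (subst nn_integral_distr) auto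
  also have "\<dots> = (\<integral>\<^sup>+\<omega>. ennreal (1 - ?m \<omega>) \<partial>M)"
  proof (rule nn_integral_cong_AE)
    show "AE \<omega> in M. emeasure ?D (Pair (S \<omega>) -` (?f -` ?A \<inter> space (?\<nu> \<Otimes>\<^sub>M ?D))) = ennreal (1 - ?m \<omega>)"
      using spectral_random_vectorD(3)[OF S]
    proof eventually_elim
      case (elim \<omega>)
      have "Pair (S \<omega>) -` (?f -` ?A \<inter> space (?\<nu> \<Otimes>\<^sub>M ?D)) =
          {e. \<forall>j. S \<omega> $ j + ereal e \<le> ereal (z $ j)}"
        by (auto simp: space_pair_measure)
      then show ?case
        using elim by (simp add: emeasure_exponential_shift)
    qed
  qed
  also have "\<dots> = ennreal (\<integral>\<omega>. 1 - ?m \<omega> \<partial>M)"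
    using int m_bounds by (intro nn_integral_eq_integral) auto
  also have "(\<integral>\<omega>. 1 - ?m \<omega> \<partial>M) = 1 - (\<integral>\<omega>. ?m \<omega> \<partial>M)"
    using int by (simp add: prob_space)
  finally have "emeasure (GP_S ?\<nu>) ?A = ennreal (1 - (\<integral>\<omega>. ?m \<omega> \<partial>M))" .
  \<comment> \<open>This makes the difference nonnegative, so \<open>ennreal\<close> does not
    truncate it and can be removed.\<close>
  moreover have "(\<integral>\<omega>. ?m \<omega> \<partial>M) \<le> 1"
    using int m_bounds by (intro integral_le_const) auto
  ultimately show ?thesis
    by (simp add: vcdf_def P.emeasure_eq_measure)
qed

section \<open>Generalized Pareto form and its parameters\<close>

text \<open>The random vector generating the stdf is \<open>exp_ext (S \<omega> $ j)\<close>
  normalised to mean 1. The condition \<open>vmax (S \<omega>) = 0\<close> becomes a maximum of 1 on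
  the exponential scale, which gives both \<open>l \<pi> = 1\<close> and the shape of the
  cdf.\<close>

lemma is_GP_GP_S:
  fixes S :: "'a \<Rightarrow> ereal ^ 'd"
  assumes S: "spectral_random_vector M S"
  defines "p \<equiv> \<lambda>j. \<integral>\<omega>. exp_ext (S \<omega> $ j) \<partial>M"
  shows "is_GP (\<chi> j. p j) (\<lambda>y. \<integral>\<omega>. vmax (\<chi> j. y $ j * (exp_ext (S \<omega> $ j) / p j)) \<partial>M)
    (GP_S (distr M borel S))"
proof -
  note [measurable] = spectral_random_vectorD(2)[OF S]
  note AE = spectral_random_vectorD(3)[OF S]
  have Sm: "S \<in> measurable M borel"
    using S by (simp add: spectral_random_vector_def random_vector_in_def)
  interpret prob_space M using S by (rule spectral_random_vectorD)
  let ?D = "density lborel (exponential_density 1)"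
  let ?\<nu> = "distr M borel S"
  let ?l = "\<lambda>y :: real ^ 'd. \<integral>\<omega>. vmax (\<chi> j. y $ j * (exp_ext (S \<omega> $ j) / p j)) \<partial>M"
  interpret D: prob_space ?D by (rule prob_space_exponential_density) simp
  interpret \<nu>: prob_space ?\<nu> using Sm by (rule prob_space_distr)
  interpret P: prob_space "GP_S ?\<nu>" using Sm by (intro prob_space_GP_S) unfold_locales
  interpret pair_sigma_finite ?\<nu> ?D ..
  have R[measurable]: "(\<lambda>\<omega>. exp_ext (S \<omega> $ j)) \<in> borel_measurable M" for j
    by (intro borel_measurable_exp_ext) simp
  have R_bounds: "AE \<omega> in M. \<forall>j. 0 \<le> exp_ext (S \<omega> $ j) \<and> exp_ext (S \<omega> $ j) \<le> 1"
    using AE by eventually_elim (auto simp: exp_ext_nonneg exp_ext_le_1)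
  have S_fin: "AE \<omega> in M. \<forall>j. S \<omega> $ j < \<infinity>"
    using AE
  proof eventually_elim
    case (elim \<omega>)
    then show ?case
      using le_less_trans[of "S \<omega> $ _" 0 \<infinity>] by simp
  qed
  have R_vmax: "AE \<omega> in M. vmax (\<chi> j. exp_ext (S \<omega> $ j)) = 1"
    using AE S_fin
  proof eventually_elim
    case (elim \<omega>)
    then show ?case
      using elim by (simp add: exp_ext_vmax[symmetric] exp_ext_0)
  qed
  have int: "integrable M (\<lambda>\<omega>. exp_ext (S \<omega> $ j))" for j
    using R_bounds by (intro integrable_const_bound[of _ 1]) auto
  have p_le: "p j \<le> 1" for j
    unfolding p_def using int R_bounds by (intro integral_le_const) (auto elim!: eventually_mono)
  have p_pos: "0 < p j" for j
  proof -
    \<comment> \<open>A nonnegative variable with mean 0 vanishes almost surely, which would force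
      \<open>S \<omega> $ j = -\<infinity>\<close> almost surely.\<close>
    have "p j \<noteq> 0"
    proof
      assume "p j = 0"
      then have "AE \<omega> in M. exp_ext (S \<omega> $ j) = 0"
        unfolding p_def using int by (subst (asm) integral_nonneg_eq_0_iff_AE) (auto simp: exp_ext_nonneg)
      then have "AE \<omega> in M. \<not> S \<omega> $ j > -\<infinity>"
        by eventually_elim (metis exp_ext_pos_iff less_irrefl)
      then have "\<P>(\<omega> in M. S \<omega> $ j > -\<infinity>) = 0"
        by (subst prob_Collect_eq_0) auto
      then show False
        using S unfolding spectral_random_vector_def by (metis less_irrefl)
    qed
    moreover have "0 \<le> p j"
      unfolding p_def by (simp add: exp_ext_nonneg)
    ultimately show ?thesis by simp
  qed
  have stdf: "is_stdf ?l"
  proof -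
    \<comment> \<open>\<open>is_stdf\<close> asks for a measure on \<open>real ^ 'd\<close>, so the
      witness is the law of \<open>V\<close> together with the identity map.\<close>
    define V where "V = (\<lambda>\<omega>. \<chi> j. exp_ext (S \<omega> $ j) / p j)"
    have V: "V \<in> borel_measurable M"
      unfolding V_def by (intro borel_measurable_vec_lambda_real) simp
    have comp: "(\<lambda>x :: real ^ 'd. x $ j) \<in> borel_measurable borel" for j
      by (intro borel_measurable_continuous_onI continuous_intros)
    have max: "(\<lambda>x :: real ^ 'd. vmax (\<chi> j. y $ j * x $ j)) \<in> borel_measurable borel" for y :: "real ^ 'd"
      by (intro borel_measurable_vmax borel_measurable_times comp) simp
    have "random_vector_in (distr M borel V) {x. \<forall>j. 0 \<le> x $ j} (\<lambda>x. x)"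
      unfolding random_vector_in_def
    proof (intro conjI)
      show "prob_space (distr M borel V)" using V by (rule prob_space_distr)
      have "{x \<in> space borel. \<forall>j. 0 \<le> (x :: real ^ 'd) $ j} \<in> sets borel"
        using comp by (intro sets.sets_Collect_countable_All) (auto intro!: borel_measurable_le)
      then show "AE x in distr M borel V. x \<in> {x. \<forall>j. 0 \<le> x $ j}"
        using V p_pos by (subst AE_distr_iff) (auto simp: V_def exp_ext_nonneg less_imp_le)
    qed simp
    moreover have "integrable (distr M borel V) (\<lambda>x. x $ j)" "(\<integral>x. x $ j \<partial>distr M borel V) = 1" for j
      using V comp int p_pos[of j] p_def
      by (simp_all add: integrable_distr_eq integral_distr V_def)
    moreover have "?l y = (\<integral>x. vmax (\<chi> j. y $ j * x $ j) \<partial>distr M borel V)" for y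
      using V max by (simp add: integral_distr V_def)
    ultimately show ?thesis
      unfolding is_stdf_def by blast
  qed
  \<comment> \<open>The normalisation cancels against the argument; \<open>w = 1\<close> then yields
    \<open>l \<pi> = 1\<close>.\<close>
  have l_p: "?l (\<chi> j. p j * w j) = (\<integral>\<omega>. vmax (\<chi> j. exp_ext (S \<omega> $ j) * w j) \<partial>M)" for w
    using p_pos by (simp add: less_imp_neq[symmetric] mult.commute)
  have norm: "?l (\<chi> j. p j) = 1"
    using integral_cong_AE[OF _ _ R_vmax] l_p[of "\<lambda>_. 1"]
    by (simp add: prob_space borel_measurable_vmax)
  have cdf: "vcdf (GP_S ?\<nu>) z =
      ?l (\<chi> j. p j * exp (- min (z $ j) 0)) - ?l (\<chi> j. p j * exp (- (z $ j)))" for z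
  proof -
    let ?a = "\<lambda>\<omega>. vmax (\<chi> j. exp_ext (S \<omega> $ j) * exp (- (z $ j)))"
    have int_a: "integrable M (\<lambda>\<omega>. vmax (\<chi> j. exp_ext (S \<omega> $ j) * w j))" for w
      using integrable_vmax_mult[of M "\<lambda>\<omega>. \<chi> j. exp_ext (S \<omega> $ j)" "\<chi> j. w j"] int
      by (simp add: mult.commute)
    have *: "vmax (\<chi> j. exp_ext (S \<omega> $ j) * exp (- min (z $ j) 0)) = max 1 (?a \<omega>)"
      if "vmax (\<chi> j. exp_ext (S \<omega> $ j)) = 1" for \<omega>
    proof -
      \<comment> \<open>The factor \<open>exp (- min (z $ j) 0)\<close> is the larger of 1 and
        \<open>exp (- (z $ j))\<close>. Maximising over \<open>j\<close> separates the two, and the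
        first maximum is 1; equality follows by comparing upper bounds.\<close>
      have "exp_ext (S \<omega> $ j) * exp (- min (z $ j) 0) =
          max (exp_ext (S \<omega> $ j)) (exp_ext (S \<omega> $ j) * exp (- (z $ j)))" for j
        using mult_left_mono[of 1 "exp (- (z $ j))" "exp_ext (S \<omega> $ j)"]
          mult_left_mono[of "exp (- (z $ j))" 1 "exp_ext (S \<omega> $ j)"]
        by (auto simp: exp_ext_nonneg min_def max_def)
      then have le_iff: "vmax (\<chi> j. exp_ext (S \<omega> $ j) * exp (- min (z $ j) 0)) \<le> b \<longleftrightarrow> max 1 (?a \<omega>) \<le> b" for b
        using vmax_le_iff[of "\<chi> j. exp_ext (S \<omega> $ j)" b] that by (auto simp: vmax_le_iff)
      show ?thesis
        by (rule order_antisym[OF iffD2[OF le_iff order_refl] iffD1[OF le_iff order_refl]])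
    qed
    have "?l (\<chi> j. p j * exp (- min (z $ j) 0)) - ?l (\<chi> j. p j * exp (- (z $ j))) =
        (\<integral>\<omega>. vmax (\<chi> j. exp_ext (S \<omega> $ j) * exp (- min (z $ j) 0)) - ?a \<omega> \<partial>M)"
      unfolding l_p using int_a by (intro Bochner_Integration.integral_diff[symmetric])
    also have "\<dots> = (\<integral>\<omega>. 1 - min 1 (?a \<omega>) \<partial>M)"
    proof (rule integral_cong_AE)
      show "AE \<omega> in M. vmax (\<chi> j. exp_ext (S \<omega> $ j) * exp (- min (z $ j) 0)) - ?a \<omega> = 1 - min 1 (?a \<omega>)"
        using R_vmax
      proof eventually_elim
        case (elim \<omega>)
        show ?case unfolding *[OF elim] by (simp add: min_def max_def)
      qed
    qed (intro borel_measurable_diff borel_measurable_min borel_measurable_const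
        borel_measurable_integrable[OF int_a])+
    also have "\<dots> = 1 - (\<integral>\<omega>. min 1 (?a \<omega>) \<partial>M)"
      using int_a[of "\<lambda>j. exp (- (z $ j))"] by (simp add: prob_space)
    finally show ?thesis
      by (simp add: vcdf_GP_S[OF S])
  qed
  have lt: "{x \<in> space borel. \<forall>j. (x :: ereal ^ 'd) $ j < \<infinity>} \<in> sets borel"
    by (intro sets.sets_Collect_countable_All borel_measurable_less borel_measurable_vec_component
        borel_measurable_const)
  have le: "{x \<in> space borel. \<forall>j. (x :: ereal ^ 'd) $ j \<le> 0} \<in> sets borel"
    by (intro sets.sets_Collect_countable_All borel_measurable_le borel_measurable_vec_component
        borel_measurable_const)
  have "AE x in GP_S ?\<nu>. \<forall>j. x $ j < \<infinity>"
    unfolding GP_S_def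
  proof (subst AE_distr_iff[OF borel_measurable_GP_S_sum lt])
    have "AE s in ?\<nu>. \<forall>j. s $ j < \<infinity>"
      using S_fin lt Sm by (subst AE_distr_iff) simp_all
    then have "AE s in ?\<nu>. AE e in ?D. \<forall>j. (case (s, e) of (s, e) \<Rightarrow> \<chi> j. s $ j + ereal e) $ j < \<infinity>"
      by eventually_elim (intro AE_I2, simp)
    moreover have "{p \<in> space (?\<nu> \<Otimes>\<^sub>M ?D). \<forall>j. (case p of (s, e) \<Rightarrow> \<chi> j. s $ j + ereal e) $ j < \<infinity>}
        \<in> sets (?\<nu> \<Otimes>\<^sub>M ?D)"
      using measurable_sets[OF borel_measurable_GP_S_sum lt, of M S]
      by (rule back_subst[of "\<lambda>A. A \<in> sets _"]) auto
    ultimately show "AE p in ?\<nu> \<Otimes>\<^sub>M ?D. \<forall>j. (case p of (s, e) \<Rightarrow> \<chi> j. s $ j + ereal e) $ j < \<infinity>"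
      by (intro AE_pair_measure)
  qed
  moreover have "AE x in GP_S ?\<nu>. \<not> (\<forall>j. x $ j \<le> 0)"
  proof -
    \<comment> \<open>At \<open>z = 0\<close> both terms of the cdf are \<open>l\<close> at the same
      point, so the law puts no mass on the nonpositive orthant.\<close>
    have "vcdf (GP_S ?\<nu>) 0 = 0"
      using norm by (simp add: cdf)
    then have "measure (GP_S ?\<nu>) {x \<in> space (GP_S ?\<nu>). \<forall>j. x $ j \<le> 0} = 0"
      by (simp add: vcdf_def GP_S_def zero_ereal_def)
    then show ?thesis
      using le by (subst (asm) P.prob_Collect_eq_0) (auto simp: GP_S_def)
  qed
  ultimately have "AE x in GP_S ?\<nu>. x \<in> {x. \<forall>j. x $ j < \<infinity>} - {x. \<forall>j. x $ j \<le> 0}"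
    by eventually_elim simp
  moreover have "sets (GP_S ?\<nu>) = sets borel"
    by (simp add: GP_S_def)
  ultimately show ?thesis
    unfolding is_GP_def using p_pos p_le stdf norm cdf P.prob_space_axioms by simp
qed

text \<open>Left to right is uniqueness of the parameters, compared with the pair from
  \<open>is_GP_GP_S\<close>. Right to left, \<open>is_GP_cong\<close> is required because
  \<open>l\<close> is prescribed on the orthant only.\<close>

lemma is_GP_GP_S_iff:
  fixes S :: "'a \<Rightarrow> ereal ^ 'd"
  assumes S: "spectral_random_vector M S"
  defines "p \<equiv> \<lambda>j. \<integral>\<omega>. exp_ext (S \<omega> $ j) \<partial>M"
  shows "is_GP \<pi> l (GP_S (distr M borel S)) \<longleftrightarrow>
    (\<forall>j. \<pi> $ j = p j) \<and>
    (\<forall>y. (\<forall>j. 0 \<le> y $ j) \<longrightarrow> l y = (\<integral>\<omega>. vmax (\<chi> j. y $ j * (exp_ext (S \<omega> $ j) / p j)) \<partial>M))"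
    (is "?L \<longleftrightarrow> ?p \<and> ?l")
proof
  have "(\<integral>\<omega>. exp_ext (S \<omega> $ j) \<partial>M) = p j" for j
    by (simp add: p_def)
  note GP = is_GP_GP_S[OF S, unfolded this]
  show "?p \<and> ?l" if ?L
    using is_GP_unique[OF that GP] by simp
  show ?L if "?p \<and> ?l"
  proof -
    have "\<pi> = (\<chi> j. p j)" using that by (simp add: vec_eq_iff)
    then show ?thesis
      using GP is_GP_cong[of l "\<lambda>y. \<integral>\<omega>. vmax (\<chi> j. y $ j * (exp_ext (S \<omega> $ j) / p j)) \<partial>M"] that
      by blast
  qed
qed

section \<open>From \<open>T\<close> to the spectral random vector\<close>

lemma vmax_diff:
  fixes x :: "ereal ^ 'd"
  assumes "\<bar>a\<bar> \<noteq> \<infinity>"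
  shows "vmax (\<chi> j. x $ j - a) = vmax x - a"
proof -
  obtain i where "x $ i = vmax x" using vmax_attained by blast
  then show ?thesis
    by (intro vmax_eqI[of _ _ i]) (auto intro: ereal_minus_mono le_vmax)
qed

text \<open>Almost surely \<open>vmax (T \<omega>)\<close> is finite: above
  \<open>-\<infinity>\<close> by \<open>T2\<close>, below \<open>\<infinity>\<close> as a maximum of
  finitely many such values. Subtracting it then moves the maximum to 0 and does not change which
  coordinates equal \<open>-\<infinity>\<close>.\<close>

lemma spectral_random_vector_minus_vmax:
  fixes T :: "'a \<Rightarrow> ereal ^ 'd"
  assumes T: "random_vector_in M {x. \<forall>j. x $ j < \<infinity>} T"
    and T1: "\<And>j. \<P>(\<omega> in M. T \<omega> $ j > -\<infinity>) > 0"
    and T2: "\<P>(\<omega> in M. vmax (T \<omega>) > -\<infinity>) = 1"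
  shows "AE \<omega> in M. (\<forall>j. T \<omega> $ j < \<infinity>) \<and> \<bar>vmax (T \<omega>)\<bar> \<noteq> \<infinity>"
    and "spectral_random_vector M (\<lambda>\<omega>. \<chi> j. T \<omega> $ j - vmax (T \<omega>))"
proof -
  interpret prob_space M using T by (simp add: random_vector_in_def)
  have [measurable]: "(\<lambda>\<omega>. T \<omega> $ j) \<in> borel_measurable M" for j
    using T by (auto simp: random_vector_in_def intro: measurable_compose[OF _ borel_measurable_vec_component])
  then have [measurable]: "(\<lambda>\<omega>. vmax (T \<omega>)) \<in> borel_measurable M"
    using borel_measurable_vmax[of "\<lambda>\<omega> j. T \<omega> $ j"] by simp
  have "AE \<omega> in M. vmax (T \<omega>) > -\<infinity>"
    using T2 by (subst (asm) prob_Collect_eq_1) auto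
  moreover have "AE \<omega> in M. \<forall>j. T \<omega> $ j < \<infinity>"
    using T by (simp add: random_vector_in_def)
  ultimately show AE: "AE \<omega> in M. (\<forall>j. T \<omega> $ j < \<infinity>) \<and> \<bar>vmax (T \<omega>)\<bar> \<noteq> \<infinity>"
    by eventually_elim (metis vmax_less_iff abs_ereal.simps less_irrefl ereal_infinity_cases)
  have vmax0: "AE \<omega> in M. vmax (\<chi> j. T \<omega> $ j - vmax (T \<omega>)) = 0"
    using AE by eventually_elim (simp add: vmax_diff)
  then have le0: "AE \<omega> in M. \<forall>j. (\<chi> j. T \<omega> $ j - vmax (T \<omega>)) $ j \<le> 0"
    by eventually_elim (metis le_vmax)
  have "\<P>(\<omega> in M. T \<omega> $ j - vmax (T \<omega>) > -\<infinity>) = \<P>(\<omega> in M. T \<omega> $ j > -\<infinity>)" for j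
  proof (rule measure_eq_AE)
    show "AE \<omega> in M. (\<omega> \<in> {\<omega> \<in> space M. T \<omega> $ j - vmax (T \<omega>) > -\<infinity>}) = (\<omega> \<in> {\<omega> \<in> space M. T \<omega> $ j > -\<infinity>})"
      using AE
    proof eventually_elim
      case (elim \<omega>)
      then show ?case by (cases "T \<omega> $ j"; cases "vmax (T \<omega>)") auto
    qed
  qed auto
  moreover have "\<P>(\<omega> in M. vmax (\<chi> j. T \<omega> $ j - vmax (T \<omega>)) = 0) = 1"
    using vmax0 by (subst prob_Collect_eq_1)
      (auto intro!: measurable_equality_set borel_measurable_vmax borel_measurable_ereal_diff)
  ultimately show "spectral_random_vector M (\<lambda>\<omega>. \<chi> j. T \<omega> $ j - vmax (T \<omega>))"
    unfolding spectral_random_vector_def random_vector_in_def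
    using T1 le0 prob_space_axioms
    by (auto intro!: borel_measurable_vec_lambda borel_measurable_ereal_diff)
qed

text \<open>That the law is determined by \<open>\<pi>\<close> and \<open>l\<close> is expressed by
  an equivalence: the stated pair is admissible and represents the law, and any representing pair
  agrees with it, for \<open>l\<close> on the orthant.\<close>

theorem proposition4p6:
  fixes M :: "'a measure" and T S :: "'a \<Rightarrow> ereal ^ 'd"
  assumes T: "random_vector_in M {x. \<forall>j. x $ j < \<infinity>} T"
    and T1: "\<forall>j. \<P>(\<omega> in M. T \<omega> $ j > -\<infinity>) > 0"
    and T2: "\<P>(\<omega> in M. vmax (T \<omega>) > -\<infinity>) = 1"
    and S: "S = (\<lambda>\<omega>. \<chi> j. T \<omega> $ j - vmax (T \<omega>))"
  shows "spectral_random_vector M S \<and>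
    (\<forall>(\<pi> :: real ^ 'd) (l :: real ^ 'd \<Rightarrow> real).
       is_GP \<pi> l (GP_S (distr M borel S)) \<longleftrightarrow>
         (\<forall>j. \<pi> $ j = (\<integral>\<omega>. exp_ext (T \<omega> $ j - vmax (T \<omega>)) \<partial>M)) \<and>
         (\<forall>y. (\<forall>j. 0 \<le> y $ j) \<longrightarrow>
            l y = (\<integral>\<omega>. vmax (\<chi> j. y $ j * (exp_ext (T \<omega> $ j - vmax (T \<omega>)) /
                              (\<integral>\<omega>'. exp_ext (T \<omega>' $ j - vmax (T \<omega>')) \<partial>M))) \<partial>M))) \<and>
    (\<forall>z :: real ^ 'd.
       vcdf (GP_S (distr M borel S)) z =
         1 - (\<integral>\<omega>. min 1 (exp_ext (vmax (\<chi> j. T \<omega> $ j - ereal (z $ j)) - vmax (T \<omega>))) \<partial>M))"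
proof (intro conjI allI)
  note T1' = T1[rule_format]
  have spec: "spectral_random_vector M S"
    unfolding S by (rule spectral_random_vector_minus_vmax(2)[OF T T1' T2])
  then show "spectral_random_vector M S" .
  have comp: "T \<omega> $ j - vmax (T \<omega>) = S \<omega> $ j" for \<omega> j
    by (simp add: S)
  show "is_GP \<pi> l (GP_S (distr M borel S)) \<longleftrightarrow>
      (\<forall>j. \<pi> $ j = (\<integral>\<omega>. exp_ext (T \<omega> $ j - vmax (T \<omega>)) \<partial>M)) \<and>
      (\<forall>y. (\<forall>j. 0 \<le> y $ j) \<longrightarrow>
         l y = (\<integral>\<omega>. vmax (\<chi> j. y $ j * (exp_ext (T \<omega> $ j - vmax (T \<omega>)) /
                           (\<integral>\<omega>'. exp_ext (T \<omega>' $ j - vmax (T \<omega>')) \<partial>M))) \<partial>M))" for \<pi> l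
    unfolding comp by (rule is_GP_GP_S_iff[OF spec])
  show "vcdf (GP_S (distr M borel S)) z =
      1 - (\<integral>\<omega>. min 1 (exp_ext (vmax (\<chi> j. T \<omega> $ j - ereal (z $ j)) - vmax (T \<omega>))) \<partial>M)" for z
  proof -
    have [measurable]: "(\<lambda>\<omega>. T \<omega> $ j) \<in> borel_measurable M" for j
      using T by (auto simp: random_vector_in_def intro: measurable_compose[OF _ borel_measurable_vec_component])
    have [measurable]: "(\<lambda>\<omega>. vmax (T \<omega>)) \<in> borel_measurable M"
      using borel_measurable_vmax[of "\<lambda>\<omega> j. T \<omega> $ j"] by simp
    \<comment> \<open>Links the cdf in terms of \<open>S\<close> to the one in terms of
      \<open>T\<close>: the finite constant \<open>vmax (T \<omega>)\<close> moves inside the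
      maximum, and the increasing \<open>exp_ext\<close> commutes with it.\<close>
    have "AE \<omega> in M. vmax (\<chi> j. exp_ext (S \<omega> $ j) * exp (- (z $ j))) =
        exp_ext (vmax (\<chi> j. T \<omega> $ j - ereal (z $ j)) - vmax (T \<omega>))"
      using spectral_random_vector_minus_vmax(1)[OF T T1' T2]
    proof eventually_elim
      case (elim \<omega>)
      have fin: "S \<omega> $ j < \<infinity>" for j
        using elim by (cases "T \<omega> $ j"; cases "vmax (T \<omega>)") (auto simp: S)
      have fin': "S \<omega> $ j - ereal (z $ j) < \<infinity>" for j
        using fin[of j] by (cases "S \<omega> $ j") auto
      have "vmax (\<chi> j. T \<omega> $ j - ereal (z $ j)) - vmax (T \<omega>) = vmax (\<chi> j. S \<omega> $ j - ereal (z $ j))"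
        using elim by (subst vmax_diff[symmetric]) (auto simp: S minus_ereal_def ac_simps)
      also have "exp_ext \<dots> = vmax (\<chi> j. exp_ext (S \<omega> $ j) * exp (- (z $ j)))"
        using fin fin' by (subst exp_ext_vmax) (auto simp: exp_ext_diff)
      finally show ?case by simp
    qed
    then have "(\<integral>\<omega>. min 1 (vmax (\<chi> j. exp_ext (S \<omega> $ j) * exp (- (z $ j)))) \<partial>M) =
        (\<integral>\<omega>. min 1 (exp_ext (vmax (\<chi> j. T \<omega> $ j - ereal (z $ j)) - vmax (T \<omega>))) \<partial>M)"
      by (intro integral_cong_AE borel_measurable_min borel_measurable_const borel_measurable_vmax
          borel_measurable_times borel_measurable_exp_ext borel_measurable_ereal_diff
          spectral_random_vectorD(2)[OF spec]) (auto elim!: eventually_mono)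
    then show ?thesis
      by (simp add: vcdf_GP_S[OF spec])
  qed
qed

end
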